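(* Let $R$ be a commutative ring with identity and let $\tilde H_R$ be the set of sequences $\boldsymbol{a}=(a_n)_{n=1}^\infty$ of elements of $R$ with $a_1=1$. Let $(p_1,p_2,\ldots)$ be the sequence of prime numbers and, for a positive integer $n$, let $\nu_i(n)$ be the $p_i$-adic valuation of $n$. Define $F:\tilde H_R\to\tilde H_R$ by $F(\boldsymbol{a})=\boldsymbol{b}$, where $$b_n=\prod_{i=1}^{\infty}a_{\nu_i(n)+1}\qquad\text{for all } n\ge1.$$ Then $F$ is an injective group homomorphism from $(\tilde H_R,* )$ to $(\tilde H_R,\odot)$, where $*$ is the convolution (Cauchy) product and $\odot$ is the Dirichlet product; in particular $F(\boldsymbol{a}*\boldsymbol{b})=F(\boldsymbol{a})\odot F(\boldsymbol{b})$ for all $\boldsymbol{a},\boldsymbol{b}\in\tilde H_R$.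
   Context: The convolution product is $\boldsymbol{a}*\boldsymbol{b}=\boldsymbol{c}$ with $c_{n+1}=\sum_{h=0}^n a_{h+1}b_{n-h+1}$ for $n\ge0$. The Dirichlet product is $\boldsymbol{a}\odot\boldsymbol{b}=\boldsymbol{c}$ with $c_n=\sum_{d\mid n}a_d\,b_{n/d}$ for $n\ge1$. Both make $\tilde H_R$ a group with identity $(1,0,0,\ldots)$. The product defining $b_n$ is finite in effect, since $\nu_i(n)=0$ for all but finitely many $i$ and $a_1=1$. *)

theory Defs
  imports "HOL-Algebra.Group" "HOL-Library.Infinite_Set" "HOL-Library.Groups_Big_Fun"
    "HOL-Computational_Algebra.Primes"
begin

(* Commutative rings with identity are rendered by the sort {comm_ring, comm_monoid_mult}
   rather than by comm_ring_1, because the latter excludes the zero ring. *)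

(* Sequences are indexed by the positive integers; they are functions on nat whose value at 0 is
   fixed to undefined, so that equality of functions is equality of sequences. *)
definition seqs_one :: "(nat \<Rightarrow> 'a::{comm_ring, comm_monoid_mult}) set" where
  "seqs_one = {a \<in> extensional {1..}. a 1 = 1}"

definition seq_unit :: "nat \<Rightarrow> 'a::{comm_ring, comm_monoid_mult}" where
  "seq_unit = (\<lambda>n\<in>{1..}. if n = 1 then 1 else 0)"

(* c_(n+1) = sum_(h=0..n) a_(h+1) b_(n-h+1), written at the index m = n + 1. *)
definition cauchy_prod ::
  "(nat \<Rightarrow> 'a::{comm_ring, comm_monoid_mult}) \<Rightarrow> (nat \<Rightarrow> 'a) \<Rightarrow> nat \<Rightarrow> 'a" where
  "cauchy_prod a b =
     (\<lambda>m\<in>{1..}. let n = m - 1 in \<Sum>h=0..n. a (h + 1) * b (n - h + 1))"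

definition dirichlet_prod ::
  "(nat \<Rightarrow> 'a::{comm_ring, comm_monoid_mult}) \<Rightarrow> (nat \<Rightarrow> 'a) \<Rightarrow> nat \<Rightarrow> 'a" where
  "dirichlet_prod a b = (\<lambda>n\<in>{1..}. \<Sum>d | d dvd n. a d * b (n div d))"

definition cauchy_group :: "(nat \<Rightarrow> 'a::{comm_ring, comm_monoid_mult}) monoid" where
  "cauchy_group = \<lparr>carrier = seqs_one, monoid.mult = cauchy_prod, one = seq_unit\<rparr>"

definition dirichlet_group :: "(nat \<Rightarrow> 'a::{comm_ring, comm_monoid_mult}) monoid" where
  "dirichlet_group = \<lparr>carrier = seqs_one, monoid.mult = dirichlet_prod, one = seq_unit\<rparr>"

(* The primes in increasing order, numbered from 0: p_1 = nth_prime 0 = 2. *)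
definition nth_prime :: "nat \<Rightarrow> nat" where
  "nth_prime = enumerate {p. prime p}"

(* Prod_any is the product of the factors different from 1; for a in seqs_one only finitely many
   factors are. *)
definition F_map :: "(nat \<Rightarrow> 'a::{comm_ring, comm_monoid_mult}) \<Rightarrow> nat \<Rightarrow> 'a" where
  "F_map a = (\<lambda>n\<in>{1..}. Prod_any (\<lambda>i. a (multiplicity (nth_prime i) n + 1)))"

end

theory Submission
  imports Defs
begin

text \<open>
  The image F(a) is multiplicative and takes the value a(k + 1) at every prime power with
  exponent k. Hence F(a) determines a, and the homomorphism law follows by induction on the
  argument: a divisor of p^k m with p not dividing m is uniquely p^i d with i at most k and d
  dividing m, so the Dirichlet sum at p^k m is the Cauchy sum at k + 1 times the Dirichlet sum
  at m. Both products are convolutions over a commutative monoid structure on the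
  positive integers, x + y - 1 and x y respectively, in which each element has finitely many
  factorizations and y is smaller than its product with any x other than 1; this gives the
  group laws, with inverses defined by recursion.
\<close>

section \<open>Convolution groups over a monoid structure on the positive integers\<close>

locale positive_nat_monoid =
  fixes comp :: "nat \<Rightarrow> nat \<Rightarrow> nat"  (infixl "\<cdot>" 70)
  assumes closed: "1 \<le> x \<Longrightarrow> 1 \<le> y \<Longrightarrow> 1 \<le> x \<cdot> y"
    and assoc: "1 \<le> x \<Longrightarrow> 1 \<le> y \<Longrightarrow> 1 \<le> z \<Longrightarrow> x \<cdot> y \<cdot> z = x \<cdot> (y \<cdot> z)"
    and commute: "1 \<le> x \<Longrightarrow> 1 \<le> y \<Longrightarrow> x \<cdot> y = y \<cdot> x"
    and unit_left: "1 \<le> x \<Longrightarrow> 1 \<cdot> x = x"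
    and less_comp: "1 < x \<Longrightarrow> 1 \<le> y \<Longrightarrow> y < x \<cdot> y"
begin

definition factorizations :: "nat \<Rightarrow> (nat \<times> nat) set" where
  "factorizations n = {(x, y). 1 \<le> x \<and> 1 \<le> y \<and> x \<cdot> y = n}"

definition conv :: "(nat \<Rightarrow> 'a::{comm_ring, comm_monoid_mult}) \<Rightarrow> (nat \<Rightarrow> 'a) \<Rightarrow> nat \<Rightarrow> 'a" where
  "conv a b = (\<lambda>n\<in>{1..}. \<Sum>(x, y)\<in>factorizations n. a x * b y)"

lemma le_comp_right: "1 \<le> x \<Longrightarrow> 1 \<le> y \<Longrightarrow> y \<le> x \<cdot> y"
  using less_comp[of x y] unit_left[of y] by (cases "x = 1") auto

lemma le_comp_left: "1 \<le> x \<Longrightarrow> 1 \<le> y \<Longrightarrow> x \<le> x \<cdot> y"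
  using le_comp_right[of y x] commute[of x y] by simp

text \<open>Each factor is bounded by the product, on one side by \<open>less_comp\<close> and the
  unit law, on the other by commutativity. This is what makes every convolution a finite
  sum.\<close>

lemma factorizations_subset: "factorizations n \<subseteq> {..n} \<times> {..n}"
  using le_comp_left le_comp_right unfolding factorizations_def by auto

lemma finite_factorizations [simp]: "finite (factorizations n)"
  by (rule finite_subset[OF factorizations_subset]) simp

lemma factorizations_unit_left:
  "1 \<le> n \<Longrightarrow> {(x, y) \<in> factorizations n. x = 1} = {(1, n)}"
  using unit_left by (auto simp: factorizations_def)

text \<open>Both factors of 1 are at most 1. So \<open>conv a b\<close> takes the value
  \<open>a 1 * b 1\<close> at 1, and leading term 1 is preserved.\<close>

lemma factorizations_1: "factorizations 1 = {(1, 1)}"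
proof -
  have "x = 1 \<and> y = 1" if "1 \<le> x" "1 \<le> y" "x \<cdot> y = 1" for x y
    using that le_comp_left[of x y] le_comp_right[of x y] by simp
  then show ?thesis
    using unit_left[of 1] unfolding factorizations_def by blast
qed

lemma conv_at: "1 \<le> n \<Longrightarrow> conv a b n = (\<Sum>(x, y)\<in>factorizations n. a x * b y)"
  by (simp add: conv_def)

lemma conv_extensional: "conv a b \<in> extensional {1..}"
  by (simp add: conv_def)

lemma conv_in_seqs_one:
  assumes "a \<in> seqs_one" "b \<in> seqs_one"
  shows "conv a b \<in> seqs_one"
  using assms conv_extensional conv_at[of 1 a b]
  unfolding factorizations_1 by (simp add: seqs_one_def)

lemma conv_unit_left:
  assumes "b \<in> seqs_one"
  shows "conv seq_unit b = b"
proof (rule extensionalityI[OF conv_extensional])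
  show "b \<in> extensional {1..}" using assms by (simp add: seqs_one_def)
next
  fix n :: nat assume "n \<in> {1..}"
  then have n: "1 \<le> n" by simp
  have "conv seq_unit b n = (\<Sum>(x, y)\<in>{(x, y) \<in> factorizations n. x = 1}. seq_unit x * b y)"
    unfolding conv_at[OF n]
    by (rule sum.mono_neutral_right[OF finite_factorizations])
      (auto simp: seq_unit_def factorizations_def split: if_splits)
  also have "\<dots> = b n"
    unfolding factorizations_unit_left[OF n] by (simp add: seq_unit_def)
  finally show "conv seq_unit b n = b n" .
qed

lemma conv_commute: "conv a b = conv b a"
proof (rule extensionalityI[OF conv_extensional conv_extensional])
  fix n :: nat assume "n \<in> {1..}"
  then have n: "1 \<le> n" by simp
  show "conv a b n = conv b a n"
    unfolding conv_at[OF n]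
    by (rule sum.reindex_bij_witness[where i = prod.swap and j = prod.swap])
      (auto simp: factorizations_def commute mult.commute)
qed

text \<open>Both sides are the sum of \<open>a x * b y * c z\<close> over all triples with composite
  \<open>n\<close>, bracketed in the two possible ways.\<close>

lemma conv_assoc: "conv (conv a b) c = conv a (conv b c)"
proof (rule extensionalityI[OF conv_extensional conv_extensional])
  fix n :: nat assume "n \<in> {1..}"
  then have n: "1 \<le> n" by simp
  have "conv (conv a b) c n =
      (\<Sum>p\<in>factorizations n. \<Sum>q\<in>factorizations (fst p). a (fst q) * b (snd q) * c (snd p))"
    unfolding conv_at[OF n]
    by (rule sum.cong) (auto simp: factorizations_def conv_at sum_distrib_right case_prod_beta)
  also have "\<dots> = (\<Sum>(p, q)\<in>Sigma (factorizations n) (\<lambda>p. factorizations (fst p)).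
      a (fst q) * b (snd q) * c (snd p))"
    by (rule sum.Sigma) auto
  also have "\<dots> = (\<Sum>(p, q)\<in>Sigma (factorizations n) (\<lambda>p. factorizations (snd p)).
      a (fst p) * (b (fst q) * c (snd q)))"
    \<comment> \<open>The witnesses rebracket a triple. The ignored component is the composite of
      the inner pair, which that pair determines.\<close>
    by (rule sum.reindex_bij_witness[where i = "\<lambda>((x, _), (y, z)). ((x \<cdot> y, z), (x, y))"
          and j = "\<lambda>((_, z), (x, y)). ((x, y \<cdot> z), (y, z))"])
      (auto simp: factorizations_def closed assoc mult.assoc simp del: One_nat_def)
  also have "\<dots> = (\<Sum>p\<in>factorizations n. \<Sum>q\<in>factorizations (snd p).
      a (fst p) * (b (fst q) * c (snd q)))"
    by (rule sum.Sigma[symmetric]) auto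
  also have "\<dots> = conv a (conv b c) n"
    unfolding conv_at[OF n]
    by (rule sum.cong) (auto simp: factorizations_def conv_at sum_distrib_left case_prod_beta)
  finally show "conv (conv a b) c n = conv a (conv b c) n" .
qed

text \<open>
  The guard y < n excludes exactly the factorization (1, n).
\<close>

function conv_inverse :: "(nat \<Rightarrow> 'a::{comm_ring, comm_monoid_mult}) \<Rightarrow> nat \<Rightarrow> 'a" where
  "conv_inverse a n = (if n = 0 then undefined else if n = 1 then 1 else
     - (\<Sum>(x, y)\<in>factorizations n. if y < n then a x * conv_inverse a y else 0))"
  by auto
termination by (relation "measure snd") auto

declare conv_inverse.simps [simp del]

text \<open>The branch \<open>n = 0\<close> returns \<open>undefined\<close> precisely so that the
  recursion yields an element of \<open>extensional {1..}\<close>.\<close>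

lemma conv_inverse_in_seqs_one: "conv_inverse a \<in> seqs_one"
  by (auto simp: seqs_one_def extensional_def conv_inverse.simps)

text \<open>Since \<open>a 1 = 1\<close>, the factorization \<open>(1, n)\<close> contributes
  \<open>conv_inverse a n\<close> itself, and the recursion sets this value to cancel all the other
  terms.\<close>

lemma conv_inverse_right:
  assumes "a \<in> seqs_one"
  shows "conv a (conv_inverse a) = seq_unit"
proof (rule extensionalityI[OF conv_extensional])
  show "seq_unit \<in> extensional {1..}" by (simp add: seq_unit_def)
next
  fix n :: nat assume "n \<in> {1..}"
  then have n: "1 \<le> n" by simp
  show "conv a (conv_inverse a) n = seq_unit n"
  proof (cases "n = 1")
    case True
    then show ?thesis
      using conv_in_seqs_one[OF assms conv_inverse_in_seqs_one]
      by (simp add: seqs_one_def seq_unit_def)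
  next
    case False
    let ?g = "\<lambda>(x, y). a x * conv_inverse a y"
    let ?T = "factorizations n - {(1, n)}"
    have mem: "(1, n) \<in> factorizations n"
      using n unit_left by (simp add: factorizations_def)
    \<comment> \<open>At \<open>(1, n)\<close> the guard fails, so the term removed is 0.\<close>
    have "(\<Sum>(x, y)\<in>factorizations n. if y < n then a x * conv_inverse a y else 0) =
        (\<Sum>(x, y)\<in>?T. if y < n then a x * conv_inverse a y else 0)"
      by (subst sum.remove[OF _ mem]) auto
    also have "\<dots> = sum ?g ?T"
    proof (rule sum.cong)
      fix p assume "p \<in> ?T"
      moreover obtain x y where p: "p = (x, y)" by force
      \<comment> \<open>If \<open>x\<close> were 1, the unit law would give \<open>y = n\<close>,
        and this pair is excluded from \<open>?T\<close>. Hence \<open>less_comp\<close> applies and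
        the guard holds throughout \<open>?T\<close>.\<close>
      ultimately have "1 \<le> x" "1 \<le> y" "x \<cdot> y = n" "x \<noteq> 1"
        using unit_left by (auto simp: factorizations_def)
      then have "y < n" using less_comp[of x y] by simp
      then show "(case p of (x, y) \<Rightarrow> if y < n then a x * conv_inverse a y else 0) = ?g p"
        by (simp add: p)
    qed simp
    finally have "conv_inverse a n = - sum ?g ?T"
      using n False by (subst conv_inverse.simps) simp
    moreover have "conv a (conv_inverse a) n = a 1 * conv_inverse a n + sum ?g ?T"
      unfolding conv_at[OF n] by (subst sum.remove[OF _ mem]) auto
    ultimately show ?thesis
      using assms n False by (simp add: seqs_one_def seq_unit_def)
  qed
qed

lemma group_conv:
  "group \<lparr>carrier = (seqs_one :: (nat \<Rightarrow> 'a::{comm_ring, comm_monoid_mult}) set),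
     monoid.mult = conv, one = seq_unit\<rparr>"
proof (rule groupI, simp_all)
  fix a b :: "nat \<Rightarrow> 'a" assume "a \<in> seqs_one" "b \<in> seqs_one"
  then show "conv a b \<in> seqs_one" by (rule conv_in_seqs_one)
next
  show "(seq_unit :: nat \<Rightarrow> 'a) \<in> seqs_one" by (simp add: seqs_one_def seq_unit_def)
next
  fix a b c :: "nat \<Rightarrow> 'a"
  show "conv (conv a b) c = conv a (conv b c)" by (rule conv_assoc)
next
  fix a :: "nat \<Rightarrow> 'a" assume a: "a \<in> seqs_one"
  show "conv seq_unit a = a" using a by (rule conv_unit_left)
  \<comment> \<open>\<open>groupI\<close> asks for a left inverse; the recursion provides a right
    one, and commutativity exchanges them.\<close>
  show "\<exists>b\<in>seqs_one. conv b a = seq_unit"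
    using conv_inverse_in_seqs_one conv_inverse_right[OF a] conv_commute by metis
qed

end

section \<open>The Cauchy and Dirichlet products as convolutions\<close>

interpretation cauchy: positive_nat_monoid "\<lambda>x y. x + y - 1"
  by unfold_locales auto

interpretation dirichlet: positive_nat_monoid "(*)"
  by unfold_locales (auto simp: mult.assoc)

text \<open>A factorization of \<open>n\<close> under \<open>x + y - 1\<close> is determined by
  \<open>x = h + 1\<close>; then \<open>y = n - 1 - h + 1\<close>, where
  \<open>h \<le> n - 1\<close> keeps the truncated subtraction exact. At 0 both sides are
  \<open>undefined\<close>.\<close>

lemma cauchy_prod_eq_conv: "cauchy_prod = cauchy.conv"
proof (intro ext)
  fix a b :: "nat \<Rightarrow> 'a::{comm_ring, comm_monoid_mult}" and n :: nat
  show "cauchy_prod a b n = cauchy.conv a b n"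
    unfolding cauchy_prod_def cauchy.conv_def restrict_def Let_def
    by (intro if_cong refl
        sum.reindex_bij_witness[where i = "\<lambda>(x, _). x - 1" and j = "\<lambda>h. (h + 1, n - 1 - h + 1)"])
      (auto simp: cauchy.factorizations_def simp del: One_nat_def)
qed

lemma dirichlet_prod_eq_conv: "dirichlet_prod = dirichlet.conv"
proof (intro ext)
  fix a b :: "nat \<Rightarrow> 'a::{comm_ring, comm_monoid_mult}" and n :: nat
  have "(\<Sum>d | d dvd n. a d * b (n div d)) =
      (\<Sum>(x, y)\<in>dirichlet.factorizations n. a x * b y)" if "1 \<le> n"
    by (rule sum.reindex_bij_witness[where i = fst and j = "\<lambda>d. (d, n div d)"])
      (use that in \<open>auto simp: dirichlet.factorizations_def Suc_le_eq intro!: Nat.gr0I\<close>)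
  then show "dirichlet_prod a b n = dirichlet.conv a b n"
    by (simp add: dirichlet_prod_def dirichlet.conv_def)
qed

lemma group_cauchy_group: "group cauchy_group"
  unfolding cauchy_group_def cauchy_prod_eq_conv by (rule cauchy.group_conv)

lemma group_dirichlet_group: "group dirichlet_group"
  unfolding dirichlet_group_def dirichlet_prod_eq_conv by (rule dirichlet.group_conv)

section \<open>Values of \<open>F_map\<close> at prime powers, and injectivity\<close>

lemma bij_betw_nth_prime: "bij_betw nth_prime UNIV {p. prime p}"
  unfolding nth_prime_def by (rule bij_enumerate) (rule primes_infinite)

text \<open>A prime outside \<open>prime_factors n\<close> contributes \<open>a 1 = 1\<close>, so
  any finite set of primes containing the prime factors gives the same product. The bijection
  \<open>nth_prime\<close> turns indices into primes.\<close>

lemma F_map_eq_prod: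
  assumes a: "a \<in> seqs_one" and n: "1 \<le> n"
    and P: "finite P" "prime_factors n \<subseteq> P" "\<And>p. p \<in> P \<Longrightarrow> prime p"
  shows "F_map a n = (\<Prod>p\<in>P. a (multiplicity p n + 1))"
proof -
  let ?A = "nth_prime -` P"
  have bij: "bij_betw nth_prime ?A P"
  proof (rule bij_betw_subset[OF bij_betw_nth_prime])
    have "P \<subseteq> range nth_prime"
      using P(3) bij_betw_imp_surj_on[OF bij_betw_nth_prime] by auto
    then show "nth_prime ` ?A = P"
      by (simp add: image_vimage_eq Int_absorb2)
  qed simp
  have "a (multiplicity (nth_prime i) n + 1) = 1" if "i \<notin> ?A" for i
  proof -
    have "prime (nth_prime i)"
      using bij_betwE[OF bij_betw_nth_prime] by simp
    then have "\<not> nth_prime i dvd n"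
      using that P(2) n by (auto simp: prime_factors_dvd)
    then show ?thesis
      using a by (simp add: not_dvd_imp_multiplicity_0 seqs_one_def)
  qed
  then have "F_map a n = (\<Prod>i\<in>?A. a (multiplicity (nth_prime i) n + 1))"
    using n bij_betw_finite[OF bij] P(1) unfolding F_map_def
    by (auto intro!: Prod_any.expand_superset)
  also have "\<dots> = (\<Prod>p\<in>P. a (multiplicity p n + 1))"
    by (rule prod.reindex_bij_betw[OF bij])
  finally show ?thesis .
qed

lemma F_map_1: "a \<in> seqs_one \<Longrightarrow> F_map a 1 = 1"
  using F_map_eq_prod[of a 1 "{}"] by simp

text \<open>Multiplying \<open>m\<close> by \<open>p ^ k\<close> gives \<open>p\<close> the exponent
  \<open>k\<close> and leaves the exponents of the primes dividing \<open>m\<close> unchanged.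
  Taking the product over \<open>insert p ?P\<close> also covers \<open>k = 0\<close>, where
  \<open>p\<close> contributes the factor 1.\<close>

lemma F_map_prime_power_times:
  assumes a: "a \<in> seqs_one" and p: "prime p" and m: "1 \<le> m" and ndvd: "\<not> p dvd m"
  shows "F_map a (p ^ k * m) = a (k + 1) * F_map a m"
proof -
  let ?P = "prime_factors m"
  have pos: "1 \<le> p ^ k * m" using m prime_gt_0_nat[OF p] by simp
  have notin: "p \<notin> ?P" using ndvd by auto
  have sub: "prime_factors (p ^ k * m) \<subseteq> insert p ?P"
  proof
    fix q assume "q \<in> prime_factors (p ^ k * m)"
    then have q: "prime q" "q dvd p ^ k * m" by auto
    then consider "q dvd p ^ k" | "q dvd m" by (auto simp: prime_dvd_mult_iff)
    then show "q \<in> insert p ?P"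
    proof cases
      case 1
      then show ?thesis using q(1) p prime_dvd_power primes_dvd_imp_eq by blast
    next
      case 2
      then show ?thesis using q(1) m by (simp add: prime_factors_dvd)
    qed
  qed
  have mult_p: "multiplicity p (p ^ k * m) = k"
    using p m ndvd by (simp add: prime_elem_multiplicity_mult_distrib not_dvd_imp_multiplicity_0)
  have mult_q: "multiplicity q (p ^ k * m) = multiplicity q m" if "q \<in> ?P" for q
  proof -
    have q: "prime q" "q \<noteq> p" using that notin by auto
    then show ?thesis
      using p m by (simp add: prime_elem_multiplicity_mult_distrib multiplicity_distinct_prime_power)
  qed
  have "F_map a (p ^ k * m) = (\<Prod>q\<in>insert p ?P. a (multiplicity q (p ^ k * m) + 1))"
    using p by (intro F_map_eq_prod[OF a pos _ sub]) auto
  also have "\<dots> = a (k + 1) * (\<Prod>q\<in>?P. a (multiplicity q m + 1))"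
    using notin mult_p mult_q by simp
  also have "(\<Prod>q\<in>?P. a (multiplicity q m + 1)) = F_map a m"
    by (rule F_map_eq_prod[OF a m, symmetric]) auto
  finally show ?thesis .
qed

lemma F_map_in_seqs_one:
  assumes "a \<in> seqs_one"
  shows "F_map a \<in> seqs_one"
  using F_map_1[OF assms] by (simp add: seqs_one_def F_map_def)

lemma F_map_prime_power:
  "a \<in> seqs_one \<Longrightarrow> prime p \<Longrightarrow> F_map a (p ^ k) = a (k + 1)"
  using F_map_prime_power_times[of a p 1 k] F_map_1[of a] prime_gt_1_nat[of p] by simp

lemma inj_on_F_map: "inj_on F_map seqs_one"
proof (rule inj_onI)
  fix a b :: "nat \<Rightarrow> 'a::{comm_ring, comm_monoid_mult}"
  assume a: "a \<in> seqs_one" and b: "b \<in> seqs_one" and eq: "F_map a = F_map b"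
  show "a = b"
  proof (rule extensionalityI)
    show "a \<in> extensional {1..}" "b \<in> extensional {1..}"
      using a b by (simp_all add: seqs_one_def)
    fix n :: nat assume "n \<in> {1..}"
    \<comment> \<open>The entry \<open>a n\<close> is read off at the argument
      \<open>2 ^ (n - 1)\<close>; as \<open>n\<close> is positive, the shifted exponent
      \<open>n - 1 + 1\<close> is \<open>n\<close>.\<close>
    then show "a n = b n"
      using F_map_prime_power[OF a two_is_prime_nat, of "n - 1"]
        F_map_prime_power[OF b two_is_prime_nat, of "n - 1"] eq by simp
  qed
qed

section \<open>Splitting off a prime power, and the homomorphism law\<close>

lemma bij_betw_divisors_prime_power_times:
  fixes p m :: nat
  assumes p: "prime p" and m: "1 \<le> m" and ndvd: "\<not> p dvd m"
  shows "bij_betw (\<lambda>(i, d). p ^ i * d) ({0..k} \<times> {d. d dvd m}) {d. d dvd p ^ k * m}"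
proof (rule bij_betw_imageI)
  \<comment> \<open>The exponent \<open>i\<close> is recovered from \<open>p ^ i * d\<close> as its
    multiplicity at \<open>p\<close>, because \<open>d\<close> is prime to \<open>p\<close>.
    Injectivity follows by cancelling \<open>p ^ i\<close>.\<close>
  have mult: "multiplicity p (p ^ i * d) = i" if "d dvd m" for i d
  proof -
    have "\<not> p dvd d" "d \<noteq> 0" using that ndvd m dvd_trans by auto
    then show ?thesis
      using p by (simp add: prime_elem_multiplicity_mult_distrib not_dvd_imp_multiplicity_0)
  qed
  show "inj_on (\<lambda>(i, d). p ^ i * d) ({0..k} \<times> {d. d dvd m})"
  proof (rule inj_onI, clarify)
    fix i d j e assume "d dvd m" "e dvd m" and eq: "p ^ i * d = p ^ j * e"
    then have "i = j" using mult[of d i] mult[of e j] by simp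
    then show "i = j \<and> d = e" using eq p by (simp add: prime_gt_0_nat)
  qed
  show "(\<lambda>(i, d). p ^ i * d) ` ({0..k} \<times> {d. d dvd m}) = {d. d dvd p ^ k * m}"
  proof (intro equalityI subsetI)
    fix x assume "x \<in> (\<lambda>(i, d). p ^ i * d) ` ({0..k} \<times> {d. d dvd m})"
    then show "x \<in> {d. d dvd p ^ k * m}" by (auto intro!: mult_dvd_mono le_imp_power_dvd)
  next
    fix x assume "x \<in> {d. d dvd p ^ k * m}"
    \<comment> \<open>A divisor of a product is a product of divisors of the two factors, and the
      divisors of \<open>p ^ k\<close> are the powers \<open>p ^ i\<close> with
      \<open>i \<le> k\<close>.\<close>
    then obtain u d where "x = u * d" "u dvd p ^ k" "d dvd m"
      using division_decomp[of x "p ^ k" m] by auto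
    moreover then obtain i where "i \<le> k" "u = p ^ i"
      using divides_primepow_nat[OF p] by auto
    ultimately show "x \<in> (\<lambda>(i, d). p ^ i * d) ` ({0..k} \<times> {d. d dvd m})" by force
  qed
qed

text \<open>The divisor complementary to \<open>p ^ i * d\<close> is
  \<open>p ^ (k - i) * (m div d)\<close>. As \<open>d\<close> and \<open>m div d\<close> are prime
  to \<open>p\<close>, both values of \<open>F_map\<close> split, and the sum over pairs
  \<open>(i, d)\<close> becomes a product of two sums.\<close>

lemma dirichlet_prod_F_map_prime_power_times:
  assumes a: "a \<in> seqs_one" and b: "b \<in> seqs_one"
    and p: "prime p" and m: "1 \<le> m" and ndvd: "\<not> p dvd m"
  shows "dirichlet_prod (F_map a) (F_map b) (p ^ k * m) =
    cauchy_prod a b (k + 1) * dirichlet_prod (F_map a) (F_map b) m"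
proof -
  have pos: "1 \<le> p ^ k * m" using m prime_gt_0_nat[OF p] by simp
  have term_eq: "F_map a (p ^ i * d) * F_map b (p ^ k * m div (p ^ i * d)) =
      (a (i + 1) * b (k - i + 1)) * (F_map a d * F_map b (m div d))"
    if i: "i \<le> k" and d: "d dvd m" for i d
  proof -
    obtain e where e: "m = d * e" using d by blast
    then have de: "1 \<le> d" "1 \<le> e" "\<not> p dvd d" "\<not> p dvd e" using m ndvd by auto
    have "p ^ k * m = (p ^ i * d) * (p ^ (k - i) * e)"
      using i by (simp add: e mult_ac flip: power_add)
    then have "p ^ k * m div (p ^ i * d) = p ^ (k - i) * e"
      using de p by (simp add: prime_gt_0_nat)
    moreover have "m div d = e" using e de by simp
    ultimately show ?thesis
      using F_map_prime_power_times[OF a p de(1,3)] F_map_prime_power_times[OF b p de(2,4)]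
      by (simp add: mult_ac)
  qed
  have "dirichlet_prod (F_map a) (F_map b) (p ^ k * m) =
      (\<Sum>d | d dvd p ^ k * m. F_map a d * F_map b (p ^ k * m div d))"
    using pos by (simp add: dirichlet_prod_def)
  also have "\<dots> = (\<Sum>(i, d)\<in>{0..k} \<times> {d. d dvd m}.
      F_map a (p ^ i * d) * F_map b (p ^ k * m div (p ^ i * d)))"
    by (subst sum.reindex_bij_betw[OF bij_betw_divisors_prime_power_times[OF p m ndvd], symmetric])
      (simp add: case_prod_beta)
  also have "\<dots> = (\<Sum>(i, d)\<in>{0..k} \<times> {d. d dvd m}.
      (a (i + 1) * b (k - i + 1)) * (F_map a d * F_map b (m div d)))"
    by (rule sum.cong) (auto simp del: add_Suc_right simp: term_eq[simplified])
  also have "\<dots> = (\<Sum>i=0..k. a (i + 1) * b (k - i + 1)) *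
      (\<Sum>d | d dvd m. F_map a d * F_map b (m div d))"
    by (simp add: sum_product sum.cartesian_product)
  finally show ?thesis
    using m by (simp add: dirichlet_prod_def cauchy_prod_def)
qed

text \<open>Splitting a full prime power \<open>p ^ k\<close> off \<open>n\<close> produces the same
  factor \<open>cauchy_prod a b (k + 1)\<close> on both sides; strong induction handles the
  cofactor.\<close>

lemma F_map_cauchy_prod:
  assumes a: "a \<in> seqs_one" and b: "b \<in> seqs_one"
  shows "F_map (cauchy_prod a b) = dirichlet_prod (F_map a) (F_map b)"
proof (rule extensionalityI)
  show "F_map (cauchy_prod a b) \<in> extensional {1..}" by (simp add: F_map_def)
  show "dirichlet_prod (F_map a) (F_map b) \<in> extensional {1..}" by (simp add: dirichlet_prod_def)
  have ab: "cauchy_prod a b \<in> seqs_one"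
    unfolding cauchy_prod_eq_conv using a b by (rule cauchy.conv_in_seqs_one)
  have FaFb: "dirichlet_prod (F_map a) (F_map b) \<in> seqs_one"
    unfolding dirichlet_prod_eq_conv using a b
    by (intro dirichlet.conv_in_seqs_one F_map_in_seqs_one)
  fix n :: nat assume "n \<in> {1..}"
  then have "1 \<le> n" by simp
  then show "F_map (cauchy_prod a b) n = dirichlet_prod (F_map a) (F_map b) n"
  proof (induction n rule: less_induct)
    case (less n)
    show ?case
    proof (cases "n = 1")
      case True
      then show ?thesis using F_map_1[OF ab] FaFb by (simp add: seqs_one_def)
    next
      case False
      then obtain p where p: "prime p" "p dvd n" using prime_factor_nat by blast
      have "n \<noteq> 0" "\<not> is_unit p" using less.prems p by auto
      then obtain m where m: "n = p ^ multiplicity p n * m" "\<not> p dvd m"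
        by (rule multiplicity_decompose')
      let ?k = "multiplicity p n"
      \<comment> \<open>Since \<open>p\<close> divides \<open>n\<close>, the power split off exceeds
        1, so the cofactor \<open>m\<close> is smaller than \<open>n\<close> and the induction
        hypothesis applies to it.\<close>
      have "0 < ?k" using p \<open>n \<noteq> 0\<close> by (simp add: prime_multiplicity_gt_zero_iff)
      then have "1 < p ^ ?k" using prime_gt_1_nat[OF p(1)] by (intro one_less_power)
      moreover have m1: "1 \<le> m" using m by (auto intro: Nat.gr0I simp: Suc_le_eq)
      ultimately have "m < n" by (subst m(1)) simp
      have "F_map (cauchy_prod a b) (p ^ ?k * m) =
          cauchy_prod a b (?k + 1) * F_map (cauchy_prod a b) m"
        by (rule F_map_prime_power_times[OF ab p(1) m1 m(2)])
      also have "\<dots> = dirichlet_prod (F_map a) (F_map b) (p ^ ?k * m)"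
        unfolding dirichlet_prod_F_map_prime_power_times[OF a b p(1) m1 m(2)]
        using less.IH[OF \<open>m < n\<close> m1] by simp
      finally show ?thesis using m(1) by simp
    qed
  qed
qed

theorem mainTheorem2:
  shows "group_hom (cauchy_group :: (nat \<Rightarrow> 'a::{comm_ring, comm_monoid_mult}) monoid)
           dirichlet_group F_map
       \<and> inj_on F_map (seqs_one :: (nat \<Rightarrow> 'a) set)
       \<and> (\<forall>a\<in>seqs_one. \<forall>b\<in>seqs_one :: (nat \<Rightarrow> 'a) set.
            F_map (cauchy_prod a b) = dirichlet_prod (F_map a) (F_map b))"
proof (intro conjI ballI)
  have "F_map \<in> hom (cauchy_group :: (nat \<Rightarrow> 'a) monoid) dirichlet_group"
    by (rule homI) (simp_all add: cauchy_group_def dirichlet_group_def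
        F_map_in_seqs_one F_map_cauchy_prod)
  then show "group_hom (cauchy_group :: (nat \<Rightarrow> 'a) monoid) dirichlet_group F_map"
    using group_cauchy_group group_dirichlet_group
    by (simp add: group_hom_def group_hom_axioms_def)
qed (auto intro: inj_on_F_map F_map_cauchy_prod)

end
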